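(* Let $n\ge1$ and let $Z_1,\ldots,Z_n$ be independent random variables with $Z_i\sim\mathrm{VG}(r_i,0,\sigma_i,0)$, where $r_i,\sigma_i>0$. Put $\sigma=\sigma_1\cdots\sigma_n$. Then $Z=\prod_{i=1}^nZ_i$ has probability density function $$p(x)=\frac{1}{2^n\pi^{n/2}\sigma}\prod_{j=1}^n\frac{1}{\Gamma(r_j/2)}\;G^{2n,0}_{0,2n}\bigg(\frac{x^2}{2^{2n}\sigma^2}\;\bigg|\;\frac{r_1-1}{2},\ldots,\frac{r_n-1}{2},\underbrace{0,\ldots,0}_{n}\bigg),\qquad x\in\mathbb R\setminus\{0\}.$$
   Context: For $r,\sigma>0$, the (symmetric, centered) variance-gamma distribution $\mathrm{VG}(r,0,\sigma,0)$ is the distribution on $\mathbb R$ with density $$\frac{1}{\sigma\sqrt\pi\,\Gamma(r/2)}\Big(\frac{|x|}{2\sigma}\Big)^{\frac{r-1}{2}}K_{\frac{r-1}{2}}\Big(\frac{|x|}{\sigma}\Big),$$ where $K_\nu$ is the modified Bessel function of the second kind. The Meijer $G$-function appearing here is, for $z>0$ and real $b_1,\ldots,b_{q}$, $$G^{q,0}_{0,q}(z\,|\,b_1,\ldots,b_q)=\frac{1}{2\pi i}\int_{c-i\infty}^{c+i\infty}z^{-s}\prod_{j=1}^q\Gamma(s+b_j)\,\mathrm ds,$$ where $c$ is a real constant with $c>-b_j$ for all $j$ (so that all poles of the $\Gamma(s+b_j)$ lie to the left of the path). *)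

theory Defs
  imports "HOL-Probability.Probability"
begin

(* Modified Bessel function of the second kind, for real order and x > 0, by its standard
   integral formula (DLMF 10.32.9).  For x \<le> 0 the integral diverges and the value is 0. *)
definition bessel_K :: "real \<Rightarrow> real \<Rightarrow> real" where
  "bessel_K \<nu> x = (LBINT t:{0..}. exp (- x * cosh t) * cosh (\<nu> * t))"

(* The value at the single point x = 0, where the formula may be singular, is irrelevant
   for a Lebesgue density. *)
definition vg_density :: "real \<Rightarrow> real \<Rightarrow> real \<Rightarrow> real" where
  "vg_density r \<sigma> x =
     1 / (\<sigma> * sqrt pi * Gamma (r / 2)) * (\<bar>x\<bar> / (2 * \<sigma>)) powr ((r - 1) / 2)
       * bessel_K ((r - 1) / 2) (\<bar>x\<bar> / \<sigma>)"

(* G^{q,0}_{0,q}(z | bs) with q = length bs, for z > 0: the line from c - i*infinity to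
   c + i*infinity is parametrised by s = c + i*t, so that ds = i dt.  The abscissa c is kept
   as an argument; it is meaningful only if c > -b for all b in bs. *)
definition meijer_G :: "real \<Rightarrow> real list \<Rightarrow> real \<Rightarrow> complex" where
  "meijer_G c bs z =
     1 / (2 * complex_of_real pi * \<i>) *
       (LINT t|lborel.
          (let s = Complex c t in
             complex_of_real z powr (- s) * (\<Prod>b\<leftarrow>bs. Gamma (s + complex_of_real b)) * \<i>))"

end

theory Submission imports Defs begin

text \<open>In the variable \<open>y = ln z\<close> everything becomes additive convolution on the real line. The function
  \<open>t \<mapsto> Gamma (c + b + i t)\<close> is the Fourier transform of \<open>exp ((c + b) v - exp v)\<close>, so Fourier inversion gives
  \<open>G(exp y | b) = exp (b y - exp y)\<close>, and by Fubini each further parameter \<open>b\<close> convolves with this kernel.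
  The substitution \<open>v = ln (\<bar>x\<bar> / 2\<sigma>) + t\<close> in the convolution of the kernels for \<open>(r - 1) / 2\<close> and \<open>0\<close>
  produces the integral for the Bessel function, so the variance-gamma density is a multiple of
  \<open>G(x\<^sup>2 / 4\<sigma>\<^sup>2 | (r - 1) / 2, 0)\<close>. Finally, for independent variables with densities \<open>P (ln x\<^sup>2)\<close>
  and \<open>Q (ln x\<^sup>2)\<close> the product has density \<open>(P * Q) (ln x\<^sup>2)\<close>, again with additive convolution.\<close>

section \<open>The Gamma function on vertical lines\<close>

text \<open>Stating the substitution x = exp v as an equality of measures makes it usable for
  nonnegative and for complex integrals alike. It holds on compact intervals by the classical rule,
  and monotone convergence along [-n, n] and [exp (-n), exp n] extends it to the line and the
  half-line.\<close>

lemma distr_exp_lborel: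
  "distr (density lborel (\<lambda>v. ennreal (exp v))) borel exp = density lborel (indicator {0<..} :: real \<Rightarrow> ennreal)"
proof (rule measure_eqI)
  fix A :: "real set" assume "A \<in> sets (distr (density lborel (\<lambda>v. ennreal (exp v))) borel exp)"
  then have [measurable]: "A \<in> sets borel" by simp
  have sup: "(SUP n::nat. g x * indicator (B n) x) = g x * indicator S x"
    if "incseq B" "(\<Union>n. B n) = S" for g :: "real \<Rightarrow> ennreal" and x and B :: "nat \<Rightarrow> real set" and S
  proof -
    have inc: "incseq (\<lambda>n. indicator (B n) x :: ennreal)"
      using that(1) by (auto simp: incseq_def intro!: indicator_leI)
    have "(\<lambda>n. indicator (B n) x :: ennreal) \<longlonglongrightarrow> indicator S x"
      using LIMSEQ_indicator_incseq[OF that(1), of x] that(2) by simp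
    with LIMSEQ_SUP[OF inc] have "(SUP n. indicator (B n) x :: ennreal) = indicator S x"
      by (rule LIMSEQ_unique)
    then show ?thesis by (simp add: SUP_mult_left_ennreal[symmetric])
  qed
  have mono: "incseq (\<lambda>n x. g x * indicator (B n) x)"
    if "incseq B" for g :: "real \<Rightarrow> ennreal" and B :: "nat \<Rightarrow> real set"
    using that by (auto simp: incseq_def le_fun_def intro!: mult_left_mono indicator_leI)
  have inc: "incseq (\<lambda>n::nat. {exp (- real n)..exp (real n)})"
    by (auto simp: incseq_def intro: order_trans[rotated])
  have un: "(\<Union>n::nat. {exp (- real n)..exp (real n)}) = {0<..}"
  proof (intro equalityI subsetI)
    fix x :: real assume "x \<in> {0<..}"
    then have x: "x > 0" by simp
    obtain n :: nat where n: "\<bar>ln x\<bar> \<le> real n" using real_arch_simple by blast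
    have "exp (- real n) \<le> exp (ln x)" "exp (ln x) \<le> exp (real n)" using n by simp_all
    then show "x \<in> (\<Union>n::nat. {exp (- real n)..exp (real n)})" using x by auto
  qed (auto intro: less_le_trans[OF exp_gt_zero])
  have inc2: "incseq (\<lambda>n::nat. {- real n..real n})" by (auto simp: incseq_def)
  have un2: "(\<Union>n::nat. {- real n..real n}) = UNIV"
  proof -
    have "\<exists>n::nat. - real n \<le> x \<and> x \<le> real n" for x
      using real_arch_simple[of "\<bar>x\<bar>"] by (metis abs_le_iff minus_le_iff)
    then show ?thesis by auto
  qed
  have "emeasure (density lborel (indicator {0<..} :: real \<Rightarrow> ennreal)) A
      = (\<integral>\<^sup>+x. indicator A x * indicator {0<..} x \<partial>lborel)"
    by (simp add: emeasure_density mult.commute)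
  also have "\<dots> = (\<integral>\<^sup>+x. (SUP n::nat. ennreal (indicator A x) * indicator {exp (- real n)..exp (real n)} x) \<partial>lborel)"
    by (subst sup[OF inc un]) (simp add: ennreal_indicator)
  also have "\<dots> = (SUP n::nat. \<integral>\<^sup>+x. ennreal (indicator A x) * indicator {exp (- real n)..exp (real n)} x \<partial>lborel)"
    by (intro nn_integral_monotone_convergence_SUP mono[OF inc]) measurable
  also have "\<dots> = (SUP n::nat. \<integral>\<^sup>+x. ennreal (indicator A (exp x) * exp x) * indicator {- real n..real n} x \<partial>lborel)"
  proof (intro SUP_cong refl)
    fix n :: nat
    show "(\<integral>\<^sup>+x. ennreal (indicator A x) * indicator {exp (- real n)..exp (real n)} x \<partial>lborel)
        = (\<integral>\<^sup>+x. ennreal (indicator A (exp x) * exp x) * indicator {- real n..real n} x \<partial>lborel)"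
      using nn_integral_substitution[of exp "- real n" "real n" "indicator A" exp]
        continuous_on_exp[OF continuous_on_id, of "{- real n..real n}"]
      by (auto intro!: derivative_eq_intros continuous_intros simp: set_borel_measurable_def ennreal_mult'
          ennreal_indicator mult.assoc simp flip: ennreal_indicator)
  qed
  also have "\<dots> = (\<integral>\<^sup>+x. (SUP n::nat. ennreal (indicator A (exp x) * exp x) * indicator {- real n..real n} x) \<partial>lborel)"
    by (intro nn_integral_monotone_convergence_SUP[symmetric] mono[OF inc2]) measurable
  also have "\<dots> = (\<integral>\<^sup>+x. ennreal (indicator A (exp x) * exp x) \<partial>lborel)"
    by (subst sup[OF inc2 un2]) simp
  also have "\<dots> = emeasure (distr (density lborel (\<lambda>v. ennreal (exp v))) borel exp) A"
    using measurable_sets_borel[of exp borel A]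
    by (auto simp: emeasure_distr emeasure_density intro!: nn_integral_cong split: split_indicator)
  finally show "emeasure (distr (density lborel (\<lambda>v. ennreal (exp v))) borel exp) A
      = emeasure (density lborel (indicator {0<..} :: real \<Rightarrow> ennreal)) A" by simp
qed simp

lemma nn_integral_exp_substitution:
  fixes f :: "real \<Rightarrow> ennreal"
  assumes [measurable]: "f \<in> borel_measurable borel"
  shows "(\<integral>\<^sup>+x. f x * indicator {0<..} x \<partial>lborel) = (\<integral>\<^sup>+v. f (exp v) * ennreal (exp v) \<partial>lborel)"
proof -
  have "(\<integral>\<^sup>+x. f x * indicator {0<..} x \<partial>lborel) = (\<integral>\<^sup>+x. f x \<partial>density lborel (indicator {0<..}))"
    by (subst nn_integral_density) (auto simp: mult.commute)
  also have "\<dots> = (\<integral>\<^sup>+v. f (exp v) \<partial>density lborel (\<lambda>v. ennreal (exp v)))"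
    unfolding distr_exp_lborel[symmetric] by (subst nn_integral_distr) auto
  also have "\<dots> = (\<integral>\<^sup>+v. f (exp v) * ennreal (exp v) \<partial>lborel)"
    by (subst nn_integral_density) (auto simp: mult.commute)
  finally show ?thesis .
qed

text \<open>Euler's integral under t = exp v: the factor t^(s-1) dt becomes exp (s v) dv.\<close>

lemma
  fixes s :: complex
  assumes s: "Re s > 0"
  shows integrable_Gamma_exp: "integrable lborel (\<lambda>v. exp (s * complex_of_real v - complex_of_real (exp v)))" (is ?int)
    and Gamma_conv_integral_exp: "Gamma s = (\<integral>v. exp (s * complex_of_real v - complex_of_real (exp v)) \<partial>lborel)" (is ?eq)
proof -
  \<comment> \<open>Written through \<open>ln\<close>, the integrand is visibly Borel on the whole
    line; on t > 0 it agrees with Euler's integrand by \<open>f_eq\<close>.\<close>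
  define f where "f = (\<lambda>t. exp ((s - 1) * complex_of_real (ln t) - complex_of_real t))"
  have [measurable]: "f \<in> borel_measurable borel" unfolding f_def by measurable
  have f_eq: "of_real t powr (s - 1) / of_real (exp t) = f t" if "t > 0" for t
    using that by (simp add: f_def powr_def Ln_of_real exp_diff exp_of_real)
  have ai: "set_integrable lebesgue {0<..} f"
    using absolutely_integrable_Gamma_integral'[OF s]
    by (rule set_integrable_cong[THEN iffD1, rotated -1]) (auto simp: f_eq)
  then have si: "set_integrable lborel {0<..} f"
    unfolding set_integrable_def by (subst (asm) integrable_completion) auto
  have si': "integrable (density lborel (\<lambda>x. ennreal (indicator {0<..} x))) f"
    using si unfolding set_integrable_def by (subst integrable_density) auto
  \<comment> \<open>Euler's formula is available as a gauge integral; uniqueness of that integral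
    transfers its value to the Lebesgue integral.\<close>
  have G: "(LINT x:{0<..}|lborel. f x) = Gamma s"
  proof -
    have "(f has_integral (LINT x:{0<..}|lborel. f x)) {0<..}"
      using has_integral_set_lebesgue[OF ai]  by (simp add: set_lebesgue_integral_def integral_completion)
    moreover have "(f has_integral Gamma s) {0<..}"
      using Gamma_integral_complex'[OF s] by (rule has_integral_eq[rotated]) (simp add: f_eq)
    ultimately show ?thesis by (rule has_integral_unique)
  qed
  have D: "distr (density lborel (\<lambda>v. ennreal (exp v))) borel exp = density lborel (\<lambda>x::real. ennreal (indicator {0<..} x))"
    unfolding distr_exp_lborel by (simp add: ennreal_indicator)
  have eq: "exp v *\<^sub>R f (exp v) = exp (s * complex_of_real v - complex_of_real (exp v))" for v :: real
    by (simp add: f_def scaleR_conv_of_real exp_of_real[symmetric] exp_add[symmetric] algebra_simps del: exp_of_real)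
  have "integrable (density lborel (\<lambda>v. ennreal (exp v))) (\<lambda>v. f (exp v))"
    using si' unfolding D[symmetric] by (subst (asm) integrable_distr_eq) auto
  then have "integrable lborel (\<lambda>v. exp v *\<^sub>R f (exp v))"
    by (subst (asm) integrable_density) auto
  then show ?int by (simp only: eq)
  have "Gamma s = integral\<^sup>L (density lborel (\<lambda>x. ennreal (indicator {0<..} x))) f"
    unfolding G[symmetric] set_lebesgue_integral_def by (subst integral_density) auto
  also have "\<dots> = integral\<^sup>L (density lborel (\<lambda>v. ennreal (exp v))) (\<lambda>v. f (exp v))"
    unfolding D[symmetric] by (subst integral_distr) auto
  also have "\<dots> = (\<integral>v. exp v *\<^sub>R f (exp v) \<partial>lborel)"
    by (subst integral_density) auto
  finally show ?eq by (simp only: eq)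
qed

lemma integrable_exp_diff_exp:
  assumes "(c::real) > 0"
  shows "integrable lborel (\<lambda>v. exp (c * v - exp v))"
proof -
  have "integrable lborel (\<lambda>v. norm (exp (of_real c * complex_of_real v - complex_of_real (exp v))))"
    using assms by (intro integrable_norm integrable_Gamma_exp) simp
  then show ?thesis by (simp add: norm_exp_eq_Re)
qed

text \<open>The modulus of the integrand depends only on the real part of the argument, so the bound
  is uniform in t along a vertical line.\<close>

lemma norm_Gamma_le:
  assumes "x > 0"
  shows "norm (Gamma (Complex x t)) \<le> (\<integral>v. exp (x * v - exp v) \<partial>lborel)"
proof -
  have "norm (Gamma (Complex x t)) \<le> (\<integral>v. norm (exp (Complex x t * complex_of_real v - complex_of_real (exp v))) \<partial>lborel)"
    using assms by (subst Gamma_conv_integral_exp) (simp_all only: complex.sel integral_norm_bound)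
  then show ?thesis by (simp add: norm_exp_eq_Re)
qed

lemma continuous_Gamma_vertical:
  assumes "x > 0"
  shows "continuous_on UNIV (\<lambda>t. Gamma (Complex x t))"
proof -
  have "continuous_on {s. Re s > 0} (Gamma :: complex \<Rightarrow> complex)"
    by (intro continuous_on_Gamma) (auto elim!: nonpos_Ints_cases)
  then show ?thesis
    by (rule continuous_on_compose2) (use assms in \<open>auto simp: complex_eq intro!: continuous_intros\<close>)
qed

text \<open>Two steps of the functional equation give Gamma(s) = Gamma(s+2) / (s (s+1)). The
  numerator is bounded on the line, so Gamma decays at least like 1 / (1 + t^2).\<close>

lemma integrable_Gamma_vertical:
  assumes x: "x > 0"
  shows "integrable lborel (\<lambda>t. Gamma (Complex x t))"
proof -
  define K where "K = (\<integral>v. exp ((x + 2) * v - exp v) \<partial>lborel)"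
  \<comment> \<open>Both \<open>m\<close> <= 1 and \<open>m\<close> <= x^2, hence \<open>m\<close>
    (1 + t^2) <= x^2 + t^2, the squared modulus of s.\<close>
  define m where "m = min 1 (x^2)"
  have m: "m > 0" using x by (simp add: m_def)
  have K: "K \<ge> 0" by (simp add: K_def)
  have b: "norm (Gamma (Complex x t)) \<le> K / m * inverse (1 + t^2)" for t
  proof -
    let ?s = "Complex x t"
    have n: "?s \<notin> \<int>\<^sub>\<le>\<^sub>0" "?s + 1 \<notin> \<int>\<^sub>\<le>\<^sub>0" using x by (auto elim!: nonpos_Ints_cases simp: complex_eq_iff)
    have e: "Complex (x + 2) t = ?s + 1 + 1" by (simp add: complex_eq_iff)
    have "Gamma (Complex (x + 2) t) = (?s + 1) * (?s * Gamma ?s)"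
      unfolding e Gamma_plus1[OF n(2)] Gamma_plus1[OF n(1)] by simp
    then have "norm (?s + 1) * (norm ?s * norm (Gamma ?s)) \<le> K"
      using norm_Gamma_le[of "x + 2" t] x by (simp add: norm_mult K_def)
    moreover have "m * (1 + t^2) \<le> norm (?s + 1) * norm ?s"
    proof -
      have "m * 1 + m * t^2 \<le> x^2 + 1 * t^2"
        by (intro add_mono mult_right_mono) (auto simp: m_def)
      then have "m * (1 + t^2) \<le> x^2 + t^2" by (simp add: distrib_left)
      also have "\<dots> = norm ?s * norm ?s" by (simp add: cmod_def flip: power2_eq_square)
      also have "\<dots> \<le> norm (?s + 1) * norm ?s"
        using x by (intro mult_right_mono) (auto simp: cmod_def intro!: power_mono)
      finally show ?thesis .
    qed
    ultimately have "(m * (1 + t^2)) * norm (Gamma ?s) \<le> K"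
      using mult_right_mono[of "m * (1 + t^2)" "norm (?s + 1) * norm ?s" "norm (Gamma ?s)"]
      by (simp add: mult.assoc)
    moreover have "m * (1 + t^2) > 0" using m by (simp add: add_pos_nonneg)
    ultimately have "norm (Gamma ?s) \<le> K / (m * (1 + t^2))"
      by (simp add: pos_le_divide_eq mult.commute)
    then show ?thesis by (simp add: divide_inverse mult.assoc)
  qed
  have "integrable lborel (\<lambda>t::real. inverse (1 + t^2))"
    using integrable_inverse_1_plus_square by (simp add: set_integrable_def)
  then have "integrable lborel (\<lambda>t::real. K / m * inverse (1 + t^2))" by simp
  then show ?thesis
  proof (rule Bochner_Integration.integrable_bound)
    show "(\<lambda>t. Gamma (Complex x t)) \<in> borel_measurable lborel"
      using continuous_Gamma_vertical[OF x] by (simp add: borel_measurable_continuous_onI)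
    show "AE t in lborel. norm (Gamma (Complex x t)) \<le> norm (K / m * inverse (1 + t^2))"
      unfolding real_norm_def by (intro AE_I2 order_trans[OF b abs_ge_self])
  qed
qed

section \<open>Fourier inversion\<close>

text \<open>Provides the integrability needed for Fubini in the Fourier inversion and in the
  convolution formula for the G-function; in both cases the modulus is bounded by a function of one
  variable times a function of the other.\<close>

lemma integrable_pair_dominated_product:
  fixes f :: "real \<Rightarrow> real \<Rightarrow> 'b::{banach, second_countable_topology}" and a b :: "real \<Rightarrow> real"
  assumes f: "case_prod f \<in> borel_measurable (lborel \<Otimes>\<^sub>M lborel)"
    and a: "integrable lborel a" and b: "integrable lborel b"
    and le: "\<And>x y. norm (f x y) \<le> a x * b y"
  shows "integrable (lborel \<Otimes>\<^sub>M lborel) (case_prod f)"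
proof -
  have [measurable]: "a \<in> borel_measurable borel" "b \<in> borel_measurable borel"
    using a b by auto
  have "integrable (lborel \<Otimes>\<^sub>M lborel) (\<lambda>p. a (fst p) * b (snd p))"
  proof (rule lborel_pair.Fubini_integrable)
    show "integrable lborel (\<lambda>x. \<integral>y. norm (a (fst (x, y)) * b (snd (x, y))) \<partial>lborel)"
      using a by (simp add: abs_mult)
  qed (use b in \<open>auto intro!: AE_I2\<close>)
  then show ?thesis
    by (rule Bochner_Integration.integrable_bound[OF _ f])
      (auto intro!: AE_I2 order_trans[OF le])
qed

text \<open>The Gaussian is its own Fourier transform up to a constant; this is read off from the
  characteristic function of the standard normal law. Each side contributes one factor sqrt (2
  pi).\<close>

lemma
  shows integrable_exp_neg_square: "integrable lborel (\<lambda>s::real. exp (- s\<^sup>2 / 2))"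
    and integral_iexp_exp_neg_square:
      "(\<integral>s. iexp (s * d) * complex_of_real (exp (- s\<^sup>2 / 2)) \<partial>lborel) = complex_of_real (2 * pi * std_normal_density d)"
proof -
  have e: "exp (- s\<^sup>2 / 2) = sqrt (2 * pi) * std_normal_density s" for s :: real
    by (simp add: std_normal_density_def)
  show "integrable lborel (\<lambda>s::real. exp (- s\<^sup>2 / 2))"
    unfolding e by (intro integrable_mult_right integrable_normal_density) simp
  have "(\<integral>s. iexp (s * d) * complex_of_real (exp (- s\<^sup>2 / 2)) \<partial>lborel)
      = (\<integral>s. complex_of_real (sqrt (2 * pi)) * (std_normal_density s *\<^sub>R iexp (d * s)) \<partial>lborel)"
    unfolding e by (intro Bochner_Integration.integral_cong) (auto simp: scaleR_conv_of_real mult.commute)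
  also have "\<dots> = complex_of_real (sqrt (2 * pi)) * (\<integral>s. std_normal_density s *\<^sub>R iexp (d * s) \<partial>lborel)"
    by (rule integral_mult_right_zero)
  also have "(\<integral>s. std_normal_density s *\<^sub>R iexp (d * s) \<partial>lborel) = char std_normal_distribution d"
    unfolding char_def by (subst integral_density) auto
  also have "\<dots> = complex_of_real (sqrt (2 * pi) * std_normal_density d)"
    by (simp add: char_std_normal_distribution e[symmetric])
  also have "complex_of_real (sqrt (2 * pi)) * \<dots> = complex_of_real (2 * pi * std_normal_density d)"
    unfolding of_real_mult[symmetric] by (simp flip: mult.assoc)
  finally show "(\<integral>s. iexp (s * d) * complex_of_real (exp (- s\<^sup>2 / 2)) \<partial>lborel) = complex_of_real (2 * pi * std_normal_density d)" .
qed

text \<open>Inserting the Gaussian factor \<open>exp (- (e * t)\<^sup>2 / 2)\<close> into the inverse transform makes Fubini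
  applicable and turns the integral into an average of \<open>f\<close> around \<open>y\<close> on scale \<open>e\<close>; then \<open>e \<rightarrow> 0\<close>.\<close>
theorem Fourier_inversion_bounded_continuous:
  fixes f :: "real \<Rightarrow> real"
  assumes f: "integrable lborel f" and cont: "continuous_on UNIV f" and bdd: "\<And>x. \<bar>f x\<bar> \<le> B"
    and \<phi>: "\<And>t. \<phi> t = (\<integral>v. complex_of_real (f v) * iexp (t * v) \<partial>lborel)"
    and int: "integrable lborel \<phi>"
  shows "(\<integral>t. iexp (- (t * y)) * \<phi> t \<partial>lborel) = complex_of_real (2 * pi * f y)"
proof -
  have [measurable]: "f \<in> borel_measurable borel" "\<phi> \<in> borel_measurable borel"
    using f int by auto
  have reg: "(\<integral>t. iexp (- (t * y)) * \<phi> t * complex_of_real (exp (- (e * t)\<^sup>2 / 2)) \<partial>lborel)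
      = complex_of_real (2 * pi * (\<integral>w. std_normal_density w * f (y + e * w) \<partial>lborel))"
    if e: "e > 0" for e :: real
  proof -
    let ?g = "\<lambda>t v. complex_of_real (f v) * (iexp (t * (v - y)) * complex_of_real (exp (- (e * t)\<^sup>2 / 2)))"
    \<comment> \<open>Substituting s = e t reduces this to the standard Gaussian. As a function of
      \<open>d\<close> the result is 2 pi times the normal density with standard deviation
      e.\<close>
    have inner: "(\<integral>t. iexp (t * d) * complex_of_real (exp (- (e * t)\<^sup>2 / 2)) \<partial>lborel)
        = complex_of_real (2 * pi / e * std_normal_density (d / e))" for d
    proof -
      have "complex_of_real (2 * pi * std_normal_density (d / e))
        = (\<integral>s. iexp (s * (d / e)) * complex_of_real (exp (- s\<^sup>2 / 2)) \<partial>lborel)"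
        by (rule integral_iexp_exp_neg_square[symmetric])
      also have "\<dots> = e *\<^sub>R (\<integral>t. iexp (t * d) * complex_of_real (exp (- (e * t)\<^sup>2 / 2)) \<partial>lborel)"
        by (subst lborel_integral_real_affine[where c = e and t = 0]) (use e in auto)
      finally show ?thesis using e by (simp add: field_simps scaleR_conv_of_real)
    qed
    have "integrable lborel (\<lambda>t. exp (- (e * t)\<^sup>2 / 2))"
      using lborel_integrable_real_affine[OF integrable_exp_neg_square, of e 0] e by simp
    then have gi: "integrable (lborel \<Otimes>\<^sub>M lborel) (case_prod ?g)"
      by (rule integrable_pair_dominated_product[where b = "\<lambda>v. \<bar>f v\<bar>", rotated])
        (use f in \<open>auto simp: norm_mult\<close>)
    have "(\<integral>t. iexp (- (t * y)) * \<phi> t * complex_of_real (exp (- (e * t)\<^sup>2 / 2)) \<partial>lborel)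
        = (\<integral>t. (\<integral>v. ?g t v \<partial>lborel) \<partial>lborel)"
    proof (intro Bochner_Integration.integral_cong refl)
      fix t
      have "iexp (- (t * y)) * \<phi> t * complex_of_real (exp (- (e * t)\<^sup>2 / 2))
          = (iexp (- (t * y)) * complex_of_real (exp (- (e * t)\<^sup>2 / 2))) * \<phi> t" by simp
      also have "\<dots> = (\<integral>v. (iexp (- (t * y)) * complex_of_real (exp (- (e * t)\<^sup>2 / 2)))
           * (complex_of_real (f v) * iexp (t * v)) \<partial>lborel)"
        unfolding \<phi> by (rule integral_mult_right_zero[symmetric])
      also have "\<dots> = (\<integral>v. ?g t v \<partial>lborel)"
        by (intro Bochner_Integration.integral_cong) (auto simp: algebra_simps exp_diff exp_minus field_simps)
      finally show "iexp (- (t * y)) * \<phi> t * complex_of_real (exp (- (e * t)\<^sup>2 / 2)) = (\<integral>v. ?g t v \<partial>lborel)" .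
    qed
    also have "\<dots> = (\<integral>v. (\<integral>t. ?g t v \<partial>lborel) \<partial>lborel)"
      using gi by (rule lborel_pair.Fubini_integral[symmetric])
    also have "\<dots> = (\<integral>v. complex_of_real (f v * (2 * pi / e * std_normal_density ((v - y) / e))) \<partial>lborel)"
      by (simp only: integral_mult_right_zero inner) simp
    also have "\<dots> = complex_of_real (\<integral>v. f v * (2 * pi / e * std_normal_density ((v - y) / e)) \<partial>lborel)"
      by (rule integral_complex_of_real)
    \<comment> \<open>The substitution v = y + e w absorbs the factor 1 / e.\<close>
    also have "(\<integral>v. f v * (2 * pi / e * std_normal_density ((v - y) / e)) \<partial>lborel)
        = (\<integral>w. 2 * pi * (std_normal_density w * f (y + e * w)) \<partial>lborel)"
      by (subst lborel_integral_real_affine[OF less_imp_neq[OF e, symmetric], where t = y])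
        (simp only: real_scaleR_def integral_mult_right_zero[symmetric],
          use e in \<open>auto intro!: Bochner_Integration.integral_cong simp: field_simps\<close>)
    finally show ?thesis by simp
  qed
  \<comment> \<open>Any sequence of positive scales tending to 0 serves; dominated convergence is
    applied along it to both sides of \<open>reg\<close>.\<close>
  define E where "E k = 1 / real (Suc k)" for k
  have E: "E \<longlonglongrightarrow> 0" "E k > 0" for k
    unfolding E_def using LIMSEQ_inverse_real_of_nat by (auto simp: inverse_eq_divide)
  have "(\<lambda>k. \<integral>t. iexp (- (t * y)) * \<phi> t * complex_of_real (exp (- (E k * t)\<^sup>2 / 2)) \<partial>lborel)
      \<longlonglongrightarrow> (\<integral>t. iexp (- (t * y)) * \<phi> t \<partial>lborel)"
  proof (rule integral_dominated_convergence[where w = "\<lambda>t. norm (\<phi> t)"])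
    show "AE t in lborel. (\<lambda>k. iexp (- (t * y)) * \<phi> t * complex_of_real (exp (- (E k * t)\<^sup>2 / 2)))
        \<longlonglongrightarrow> iexp (- (t * y)) * \<phi> t"
    proof (rule AE_I2)
      fix t
      have "(\<lambda>k. iexp (- (t * y)) * \<phi> t * complex_of_real (exp (- (E k * t)\<^sup>2 / 2)))
        \<longlonglongrightarrow> iexp (- (t * y)) * \<phi> t * complex_of_real (exp (- (0 * t)\<^sup>2 / 2))"
        by (intro tendsto_intros E) simp
      then show "(\<lambda>k. iexp (- (t * y)) * \<phi> t * complex_of_real (exp (- (E k * t)\<^sup>2 / 2)))
        \<longlonglongrightarrow> iexp (- (t * y)) * \<phi> t" by simp
    qed
  qed (use int in \<open>auto simp: norm_mult intro!: AE_I2 mult_left_le\<close>)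
  \<comment> \<open>Continuity of \<open>f\<close> at \<open>y\<close> gives the pointwise limit,
    and the bound \<open>B\<close> times the normal density dominates.\<close>
  moreover have "(\<lambda>k. complex_of_real (2 * pi * (\<integral>w. std_normal_density w * f (y + E k * w) \<partial>lborel)))
      \<longlonglongrightarrow> complex_of_real (2 * pi * f y)"
  proof -
    have "(\<lambda>k. \<integral>w. std_normal_density w * f (y + E k * w) \<partial>lborel) \<longlonglongrightarrow> (\<integral>w. std_normal_density w * f y \<partial>lborel)"
    proof (rule integral_dominated_convergence[where w = "\<lambda>w. std_normal_density w * B"])
      show "AE w in lborel. (\<lambda>k. std_normal_density w * f (y + E k * w)) \<longlonglongrightarrow> std_normal_density w * f y"
      proof (rule AE_I2)
        fix w
        have "(\<lambda>k. y + E k * w) \<longlonglongrightarrow> y + 0 * w" by (intro tendsto_intros E)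
        moreover have "isCont f y" using cont by (simp add: continuous_on_eq_continuous_at)
        ultimately show "(\<lambda>k. std_normal_density w * f (y + E k * w)) \<longlonglongrightarrow> std_normal_density w * f y"
          by (intro tendsto_intros isCont_tendsto_compose[of y f]) auto
      qed
    qed (auto simp: abs_mult intro!: AE_I2 mult_left_mono bdd)
    then show ?thesis by (intro tendsto_intros) simp
  qed
  ultimately show ?thesis
    unfolding reg[OF E(2)] by (rule LIMSEQ_unique)
qed

section \<open>The Meijer G-function as an iterated convolution\<close>

text \<open>This is z^b exp (-z) at z = exp v. For b = 1 it is the density of a reflected Gumbel
  variable.\<close>

definition gumbel_kernel :: "real \<Rightarrow> real \<Rightarrow> real" where
  "gumbel_kernel b v = exp (b * v - exp v)"

lemma measurable_gumbel_kernel [measurable]: "gumbel_kernel b \<in> borel_measurable borel"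
  unfolding gumbel_kernel_def by measurable

lemma gumbel_kernel_nonneg [simp]: "0 \<le> gumbel_kernel b v"
  by (simp add: gumbel_kernel_def)

definition Gamma_prod :: "real \<Rightarrow> real list \<Rightarrow> real \<Rightarrow> complex" where
  "Gamma_prod c bs t = (\<Prod>b\<leftarrow>bs. Gamma (Complex (c + b) t))"

lemma Gamma_prod_Cons: "Gamma_prod c (b # bs) t = Gamma (Complex (c + b) t) * Gamma_prod c bs t"
  by (simp add: Gamma_prod_def)

text \<open>At z = exp y the power of z is a plain exponential, and the imaginary unit from ds = i
  dt cancels the one in 2 pi i, which leaves an inverse Fourier integral in t.\<close>

lemma meijer_G_exp:
  "meijer_G c bs (exp y)
     = 1 / (2 * complex_of_real pi) * (\<integral>t. exp (- Complex c t * complex_of_real y) * Gamma_prod c bs t \<partial>lborel)"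
proof -
  have 1: "Complex c t + complex_of_real b = Complex (c + b) t" for b t
    by (simp add: complex_eq_iff)
  have 2: "complex_of_real (exp y) powr (- s) = exp (- s * complex_of_real y)" for s
    by (simp add: powr_def Ln_of_real del: of_real_exp exp_of_real)
  have "meijer_G c bs (exp y)
     = 1 / (2 * complex_of_real pi * \<i>) * ((\<integral>t. exp (- Complex c t * complex_of_real y) * Gamma_prod c bs t \<partial>lborel) * \<i>)"
    unfolding meijer_G_def Let_def 1 2 Gamma_prod_def[symmetric] integral_mult_left_zero ..
  then show ?thesis by simp
qed

text \<open>Lets the two parameters of a new variable be moved to the front of the list in the
  induction over the number of factors.\<close>

lemma meijer_G_mset_cong: "mset bs = mset bs' \<Longrightarrow> meijer_G c bs z = meijer_G c bs' z"
  unfolding meijer_G_def by (simp only: prod_mset_prod_list[symmetric] mset_map)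

lemma measurable_Gamma_prod:
  assumes "\<forall>b\<in>set bs. c + b > 0"
  shows "Gamma_prod c bs \<in> borel_measurable borel"
  using assms
proof (induction bs)
  case (Cons b bs)
  have [measurable]: "(\<lambda>t. Gamma (Complex (c + b) t)) \<in> borel_measurable borel"
    using Cons.prems by (intro borel_measurable_continuous_onI continuous_Gamma_vertical) auto
  have [measurable]: "Gamma_prod c bs \<in> borel_measurable borel" using Cons by simp
  show ?case unfolding Gamma_prod_Cons by measurable
qed (simp add: Gamma_prod_def[abs_def])

text \<open>One factor is integrable along the line and each further one is bounded by
  \<open>norm_Gamma_le\<close>. The empty product is the constant 1, which is not
  integrable.\<close>

lemma integrable_Gamma_prod:
  assumes "\<forall>b\<in>set bs. c + b > 0" "bs \<noteq> []"
  shows "integrable lborel (Gamma_prod c bs)"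
  using assms
proof (induction bs)
  case (Cons b bs)
  show ?case
  proof (cases "bs = []")
    case True
    then show ?thesis using Cons.prems integrable_Gamma_vertical[of "c + b"]
      by (simp add: Gamma_prod_def)
  next
    case False
    have "integrable lborel (\<lambda>t. complex_of_real (\<integral>v. exp ((c + b) * v - exp v) \<partial>lborel) * Gamma_prod c bs t)"
      using Cons False by simp
    then show ?thesis
    proof (rule Bochner_Integration.integrable_bound)
      show "Gamma_prod c (b # bs) \<in> borel_measurable lborel"
        using measurable_Gamma_prod[OF Cons.prems(1)] by simp
      show "AE t in lborel. norm (Gamma_prod c (b # bs) t)
        \<le> norm (complex_of_real (\<integral>v. exp ((c + b) * v - exp v) \<partial>lborel) * Gamma_prod c bs t)"
        using Cons.prems unfolding Gamma_prod_Cons norm_mult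
        by (intro AE_I2 mult_right_mono) (auto intro!: order_trans[OF norm_Gamma_le])
    qed
  qed
qed simp

lemma exp_vertical:
  "exp (- Complex c t * complex_of_real y) = complex_of_real (exp (- c * y)) * iexp (- (t * y))"
proof -
  have "- Complex c t * complex_of_real y = complex_of_real (- c * y) + \<i> * complex_of_real (- (t * y))"
    by (simp add: complex_eq_iff)
  then show ?thesis by (simp only: exp_add exp_of_real)
qed

lemma measurable_meijer_G_exp:
  assumes "\<forall>b\<in>set bs. c + b > 0"
  shows "(\<lambda>y. meijer_G c bs (exp y)) \<in> borel_measurable borel"
proof -
  note [measurable] = measurable_Gamma_prod[OF assms]
  show ?thesis unfolding meijer_G_exp exp_vertical by measurable
qed

text \<open>Inversion recovers exp ((c + b) y - exp y), and the weight exp (- c y) from the abscissa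
  removes the dependence on \<open>c\<close>.\<close>

lemma meijer_G_singleton:
  assumes "c + b > 0"
  shows "meijer_G c [b] (exp y) = complex_of_real (gumbel_kernel b y)"
proof -
  let ?a = "c + b"
  let ?f = "\<lambda>v. exp (?a * v - exp v)"
  \<comment> \<open>The exponent is maximal at v = ln (c + b); this follows from exp u >= 1 + u with
    u = v - ln (c + b).\<close>
  have bound: "?a * v - exp v \<le> ?a * ln ?a - ?a" for v
  proof -
    have "?a * (1 + (v - ln ?a)) \<le> ?a * exp (v - ln ?a)"
      using assms by (intro mult_left_mono exp_ge_add_one_self) auto
    also have "\<dots> = exp v" using assms by (simp add: exp_diff)
    finally show ?thesis by (simp add: algebra_simps)
  qed
  have "(\<integral>t. iexp (- (t * y)) * Gamma (Complex ?a t) \<partial>lborel) = complex_of_real (2 * pi * ?f y)"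
  proof (rule Fourier_inversion_bounded_continuous)
    show "integrable lborel ?f" using assms by (rule integrable_exp_diff_exp)
    show "continuous_on UNIV ?f" by (intro continuous_intros)
    show "\<bar>?f v\<bar> \<le> exp (?a * ln ?a - ?a)" for v using bound[of v] by simp
    show "integrable lborel (\<lambda>t. Gamma (Complex ?a t))" using assms by (rule integrable_Gamma_vertical)
    fix t
    have "Complex ?a t * complex_of_real v - complex_of_real (exp v)
      = complex_of_real (?a * v - exp v) + \<i> * complex_of_real (t * v)" for v
      by (simp add: complex_eq_iff)
    then show "Gamma (Complex ?a t) = (\<integral>v. complex_of_real (?f v) * iexp (t * v) \<partial>lborel)"
      using assms by (subst Gamma_conv_integral_exp) (simp_all only: complex.sel exp_add exp_of_real)
  qed
  then have "(\<integral>t. exp (- Complex c t * complex_of_real y) * Gamma_prod c [b] t \<partial>lborel)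
    = complex_of_real (exp (- c * y)) * complex_of_real (2 * pi * ?f y)"
    by (simp only: Gamma_prod_def list.map prod_list.Cons prod_list.Nil mult_1_right exp_vertical mult.assoc integral_mult_right_zero)
  also have "\<dots> = complex_of_real (2 * pi) * complex_of_real (exp (- c * y) * ?f y)" by simp
  also have "exp (- c * y) * ?f y = gumbel_kernel b y"
    unfolding gumbel_kernel_def exp_add[symmetric] by (simp add: algebra_simps)
  finally show ?thesis unfolding meijer_G_exp by simp
qed

text \<open>The Gamma factor of \<open>b\<close> is replaced by its integral over v. After
  interchanging the integrals, the inner one over t is again a G-function, at the shifted argument y
  - v.\<close>

lemma
  assumes bs: "\<forall>b\<in>set bs. c + b > 0" "bs \<noteq> []" and b: "c + b > 0"
  shows integrable_meijer_G_convolution: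
      "integrable lborel (\<lambda>v. complex_of_real (gumbel_kernel b v) * meijer_G c bs (exp (y - v)))"
    and meijer_G_Cons:
      "meijer_G c (b # bs) (exp y)
         = (\<integral>v. complex_of_real (gumbel_kernel b v) * meijer_G c bs (exp (y - v)) \<partial>lborel)"
proof -
  note [measurable] = measurable_Gamma_prod[OF bs(1)]
  let ?k = "1 / (2 * complex_of_real pi)"
  let ?h = "\<lambda>t v. complex_of_real (gumbel_kernel b v) * (exp (- Complex c t * complex_of_real (y - v)) * Gamma_prod c bs t)"
  have int: "integrable (lborel \<Otimes>\<^sub>M lborel) (case_prod ?h)"
  proof (rule integrable_pair_dominated_product)
    show "case_prod ?h \<in> borel_measurable (lborel \<Otimes>\<^sub>M lborel)" unfolding exp_vertical by measurable
    show "integrable lborel (\<lambda>t. norm (Gamma_prod c bs t))"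
      using integrable_Gamma_prod[OF bs] by (rule integrable_norm)
    show "integrable lborel (\<lambda>v. exp (- c * y) * exp ((c + b) * v - exp v))"
      using integrable_exp_diff_exp[OF b] by simp
    fix t v
    \<comment> \<open>Taking the modulus turns exponent \<open>b\<close> into c + b, which is
      positive, so the kernel becomes integrable in v whatever the sign of \<open>b\<close>.\<close>
    have "gumbel_kernel b v * exp (- c * (y - v)) = exp (- c * y) * exp ((c + b) * v - exp v)"
      unfolding gumbel_kernel_def exp_add[symmetric] by (simp add: algebra_simps)
    moreover have "norm (?h t v) = norm (Gamma_prod c bs t) * (gumbel_kernel b v * exp (- c * (y - v)))"
      unfolding exp_vertical by (simp add: norm_mult)
    ultimately show "norm (?h t v) \<le> norm (Gamma_prod c bs t) * (exp (- c * y) * exp ((c + b) * v - exp v))"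
      by (simp only: order_refl)
  qed
  have conv: "complex_of_real (gumbel_kernel b v) * meijer_G c bs (exp (y - v)) = ?k * (\<integral>t. ?h t v \<partial>lborel)" for v
    unfolding meijer_G_exp integral_mult_right_zero by simp
  show "integrable lborel (\<lambda>v. complex_of_real (gumbel_kernel b v) * meijer_G c bs (exp (y - v)))"
    unfolding conv using lborel_pair.integrable_snd[OF int] by (rule integrable_mult_right)
  have "exp (- Complex c t * complex_of_real y) * Gamma_prod c (b # bs) t = (\<integral>v. ?h t v \<partial>lborel)" for t
  proof -
    have "exp (- Complex c t * complex_of_real y) * Gamma_prod c (b # bs) t
      = (exp (- Complex c t * complex_of_real y) * Gamma_prod c bs t) * Gamma (Complex (c + b) t)"
      by (simp add: Gamma_prod_Cons)
    also have "\<dots> = (\<integral>v. (exp (- Complex c t * complex_of_real y) * Gamma_prod c bs t)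
        * exp (Complex (c + b) t * complex_of_real v - complex_of_real (exp v)) \<partial>lborel)"
      using b by (subst Gamma_conv_integral_exp) simp_all
    also have "\<dots> = (\<integral>v. ?h t v \<partial>lborel)"
    proof (intro Bochner_Integration.integral_cong refl)
      fix v
      \<comment> \<open>With s = c + i t this is the identity - s y + (s + b) v = b v - s (y -
        v).\<close>
      have "- Complex c t * complex_of_real y + (Complex (c + b) t * complex_of_real v - complex_of_real (exp v))
        = complex_of_real (b * v - exp v) + - Complex c t * complex_of_real (y - v)"
        by (simp add: complex_eq_iff algebra_simps)
      then have "exp (- Complex c t * complex_of_real y) * exp (Complex (c + b) t * complex_of_real v - complex_of_real (exp v))
        = complex_of_real (gumbel_kernel b v) * exp (- Complex c t * complex_of_real (y - v))"
        by (simp only: gumbel_kernel_def exp_add[symmetric] exp_of_real[symmetric])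
      then show "exp (- Complex c t * complex_of_real y) * Gamma_prod c bs t
          * exp (Complex (c + b) t * complex_of_real v - complex_of_real (exp v)) = ?h t v"
        by (metis mult.assoc mult.commute)
    qed
    finally show ?thesis .
  qed
  then have "meijer_G c (b # bs) (exp y) = ?k * (\<integral>t. (\<integral>v. ?h t v \<partial>lborel) \<partial>lborel)"
    unfolding meijer_G_exp by simp
  also have "(\<integral>t. (\<integral>v. ?h t v \<partial>lborel) \<partial>lborel) = (\<integral>v. (\<integral>t. ?h t v \<partial>lborel) \<partial>lborel)"
    using int by (rule lborel_pair.Fubini_integral[symmetric])
  finally show "meijer_G c (b # bs) (exp y)
         = (\<integral>v. complex_of_real (gumbel_kernel b v) * meijer_G c bs (exp (y - v)) \<partial>lborel)"
    unfolding conv integral_mult_right_zero .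
qed

text \<open>A single parameter gives a positive kernel, and convolution with such a kernel preserves
  being real and nonnegative.\<close>

lemma meijer_G_exp_nonneg_real:
  assumes "\<forall>b\<in>set bs. c + b > 0" "bs \<noteq> []"
  shows "meijer_G c bs (exp y) = complex_of_real (Re (meijer_G c bs (exp y))) \<and> 0 \<le> Re (meijer_G c bs (exp y))"
  using assms(2,1)
proof (induction bs arbitrary: y rule: list_nonempty_induct)
  case (single b)
  then show ?case by (simp add: meijer_G_singleton)
next
  case (cons b bs)
  define h where "h y = Re (meijer_G c bs (exp y))" for y
  have h: "meijer_G c bs (exp y) = complex_of_real (h y)" "0 \<le> h y" for y
    using cons.IH[of y] cons.prems by (auto simp: h_def)
  have "meijer_G c (b # bs) (exp y) = (\<integral>v. complex_of_real (gumbel_kernel b v * h (y - v)) \<partial>lborel)"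
    using cons by (subst meijer_G_Cons) (auto simp: h(1))
  also have "\<dots> = complex_of_real (\<integral>v. gumbel_kernel b v * h (y - v) \<partial>lborel)"
    by (rule integral_complex_of_real)
  finally show ?case using h(2) by simp
qed

text \<open>Values in \<open>ennreal\<close> allow Tonelli without integrability conditions. For a
  nonempty \<open>bs\<close> with c + b > 0 throughout, neither \<open>Re\<close> nor
  \<open>ennreal\<close> loses information, by \<open>meijer_G_exp_nonneg_real\<close>.\<close>

definition meijer_E :: "real \<Rightarrow> real list \<Rightarrow> real \<Rightarrow> ennreal" where
  "meijer_E c bs y = ennreal (Re (meijer_G c bs (exp y)))"

lemma measurable_meijer_E:
  assumes "\<forall>b\<in>set bs. c + b > 0"
  shows "meijer_E c bs \<in> borel_measurable borel"
  using measurable_meijer_G_exp[OF assms] unfolding meijer_E_def by measurable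

lemma meijer_E_singleton: "c + b > 0 \<Longrightarrow> meijer_E c [b] y = ennreal (gumbel_kernel b y)"
  by (simp add: meijer_E_def meijer_G_singleton)

lemma meijer_E_Cons:
  assumes bs: "\<forall>b\<in>set bs. c + b > 0" "bs \<noteq> []" and b: "c + b > 0"
  shows "meijer_E c (b # bs) y = (\<integral>\<^sup>+v. ennreal (gumbel_kernel b v) * meijer_E c bs (y - v) \<partial>lborel)"
proof -
  define h where "h y = Re (meijer_G c bs (exp y))" for y
  have h: "meijer_G c bs (exp y) = complex_of_real (h y)" "0 \<le> h y" for y
    using meijer_G_exp_nonneg_real[OF bs, of y] by (auto simp: h_def)
  have int: "integrable lborel (\<lambda>v. gumbel_kernel b v * h (y - v))"
    using integrable_meijer_G_convolution[OF bs b, of y]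
    by (simp only: h(1) of_real_mult[symmetric] complex_of_real_integrable_eq)
  have "meijer_G c (b # bs) (exp y) = complex_of_real (\<integral>v. gumbel_kernel b v * h (y - v) \<partial>lborel)"
    using meijer_G_Cons[OF bs b, of y] by (simp only: h(1) of_real_mult[symmetric] integral_complex_of_real)
  then have "meijer_E c (b # bs) y = ennreal (\<integral>v. gumbel_kernel b v * h (y - v) \<partial>lborel)"
    by (simp add: meijer_E_def)
  also have "\<dots> = (\<integral>\<^sup>+v. ennreal (gumbel_kernel b v * h (y - v)) \<partial>lborel)"
    using int h(2) by (intro nn_integral_eq_integral[symmetric]) auto
  finally show ?thesis by (simp add: ennreal_mult' meijer_E_def h_def)
qed

section \<open>Products of symmetric random variables\<close>

lemma nn_integral_split_reflect:
  fixes f :: "real \<Rightarrow> ennreal"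
  assumes [measurable]: "f \<in> borel_measurable borel"
  shows "(\<integral>\<^sup>+x. f x \<partial>lborel) = (\<integral>\<^sup>+x. (f x + f (- x)) * indicator {0<..} x \<partial>lborel)"
proof -
  have "(\<integral>\<^sup>+x. f x \<partial>lborel) = (\<integral>\<^sup>+x. f x * indicator {0<..} x + f x * indicator {..<0} x \<partial>lborel)"
    by (intro nn_integral_cong_AE eventually_mono[OF AE_lborel_singleton[of 0]])
      (auto split: split_indicator)
  also have "\<dots> = (\<integral>\<^sup>+x. f x * indicator {0<..} x \<partial>lborel) + (\<integral>\<^sup>+x. f x * indicator {..<0} x \<partial>lborel)"
    by (intro nn_integral_add) auto
  also have "(\<integral>\<^sup>+x. f x * indicator {..<0} x \<partial>lborel) = (\<integral>\<^sup>+x. f (- x) * indicator {0<..} x \<partial>lborel)"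
    by (subst nn_integral_real_affine[where c = "-1" and t = 0])
      (auto intro!: nn_integral_cong split: split_indicator)
  also have "(\<integral>\<^sup>+x. f x * indicator {0<..} x \<partial>lborel) + \<dots> = (\<integral>\<^sup>+x. (f x + f (- x)) * indicator {0<..} x \<partial>lborel)"
    by (subst nn_integral_add[symmetric]) (auto simp: distrib_right)
  finally show ?thesis .
qed

text \<open>Substitute x = exp (v / 2) and x = - exp (v / 2): both branches have the same v = ln
  (x^2) and the Jacobian exp (v / 2) / 2. The point x = 0 is null.\<close>

lemma nn_integral_ln_square:
  fixes \<phi> P :: "real \<Rightarrow> ennreal"
  assumes [measurable]: "\<phi> \<in> borel_measurable borel" "P \<in> borel_measurable borel"
  shows "(\<integral>\<^sup>+x. \<phi> x * P (ln (x\<^sup>2)) \<partial>lborel)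
    = (\<integral>\<^sup>+v. (\<phi> (exp (v / 2)) + \<phi> (- exp (v / 2))) * ennreal (exp (v / 2) / 2) * P v \<partial>lborel)"
proof -
  have "(\<integral>\<^sup>+x. \<phi> x * P (ln (x\<^sup>2)) \<partial>lborel)
    = (\<integral>\<^sup>+x. (\<phi> x + \<phi> (- x)) * P (ln (x\<^sup>2)) * indicator {0<..} x \<partial>lborel)"
    by (subst nn_integral_split_reflect) (auto simp: distrib_right)
  also have "\<dots> = (\<integral>\<^sup>+u. (\<phi> (exp u) + \<phi> (- exp u)) * P (2 * u) * ennreal (exp u) \<partial>lborel)"
    by (subst nn_integral_exp_substitution) (auto simp: ln_realpow)
  also have "\<dots> = ennreal (1/2) * (\<integral>\<^sup>+v. (\<phi> (exp (v / 2)) + \<phi> (- exp (v / 2))) * P v * ennreal (exp (v / 2)) \<partial>lborel)"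
    by (subst nn_integral_real_affine[where c = "1/2" and t = 0]) auto
  also have "\<dots> = (\<integral>\<^sup>+v. ennreal (1/2) * ((\<phi> (exp (v / 2)) + \<phi> (- exp (v / 2))) * P v * ennreal (exp (v / 2))) \<partial>lborel)"
    by (subst nn_integral_cmult) auto
  also have "\<dots> = (\<integral>\<^sup>+v. (\<phi> (exp (v / 2)) + \<phi> (- exp (v / 2))) * ennreal (exp (v / 2) / 2) * P v \<partial>lborel)"
  proof (intro nn_integral_cong)
    fix v :: real
    have "ennreal (exp (v / 2) / 2) = ennreal (1/2) * ennreal (exp (v / 2))"
      by (subst ennreal_mult'[symmetric]) auto
    then show "ennreal (1/2) * ((\<phi> (exp (v / 2)) + \<phi> (- exp (v / 2))) * P v * ennreal (exp (v / 2)))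
      = (\<phi> (exp (v / 2)) + \<phi> (- exp (v / 2))) * ennreal (exp (v / 2) / 2) * P v"
      by (simp only: mult_ac)
  qed
  finally show ?thesis .
qed

text \<open>Because ln ((X Y)^2) = ln (X^2) + ln (Y^2), the profiles are convolved; evenness of both
  densities takes care of the signs. The proof integrates the indicator of a Borel set against the
  law of X Y.\<close>

lemma (in prob_space) distributed_mult_ln_square:
  fixes X Y :: "'a \<Rightarrow> real" and P Q :: "real \<Rightarrow> ennreal"
  assumes ind: "indep_var borel X borel Y"
    and [measurable]: "P \<in> borel_measurable borel" "Q \<in> borel_measurable borel"
    and X: "distributed M lborel X (\<lambda>x. P (ln (x\<^sup>2)))"
    and Y: "distributed M lborel Y (\<lambda>y. Q (ln (y\<^sup>2)))"
  shows "distributed M lborel (\<lambda>\<omega>. X \<omega> * Y \<omega>) (\<lambda>x. \<integral>\<^sup>+u. P u * Q (ln (x\<^sup>2) - u) \<partial>lborel)"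
  unfolding distributed_def
proof (intro conjI)
  have [measurable]: "X \<in> borel_measurable M" "Y \<in> borel_measurable M"
    using distributed_measurable[OF X] distributed_measurable[OF Y] by auto
  show "random_variable lborel (\<lambda>\<omega>. X \<omega> * Y \<omega>)" by simp
  show "(\<lambda>x. \<integral>\<^sup>+u. P u * Q (ln (x\<^sup>2) - u) \<partial>lborel) \<in> borel_measurable lborel" by measurable
  have dX: "distr M borel X = density lborel (\<lambda>x. P (ln (x\<^sup>2)))"
    using distributed_distr_eq_density[OF X] by (simp cong: distr_cong)
  have dY: "distr M borel Y = density lborel (\<lambda>x. Q (ln (x\<^sup>2)))"
    using distributed_distr_eq_density[OF Y] by (simp cong: distr_cong)
  interpret dY: prob_space "distr M borel Y" by (rule prob_space_distr) simp
  show "distr M lborel (\<lambda>\<omega>. X \<omega> * Y \<omega>) = density lborel (\<lambda>x. \<integral>\<^sup>+u. P u * Q (ln (x\<^sup>2) - u) \<partial>lborel)"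
  proof (rule measure_eqI)
    fix A assume "A \<in> sets (distr M lborel (\<lambda>\<omega>. X \<omega> * Y \<omega>))"
    then have A [measurable]: "A \<in> sets borel" by simp
    define \<phi> :: "real \<Rightarrow> ennreal" where "\<phi> = indicator A"
    have [measurable]: "\<phi> \<in> borel_measurable borel" by (simp add: \<phi>_def)
    \<comment> \<open>\<open>J x\<close> is the expectation of \<open>\<phi>\<close> (x Y), written
      in the variable v = ln (y^2).\<close>
    define J where "J x = (\<integral>\<^sup>+v. (\<phi> (x * exp (v / 2)) + \<phi> (- (x * exp (v / 2)))) * ennreal (exp (v / 2) / 2) * Q v \<partial>lborel)" for x
    have [measurable]: "J \<in> borel_measurable borel" unfolding J_def by measurable
    \<comment> \<open>The weight that \<open>nn_integral_ln_square\<close> attaches to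
      \<open>\<phi>\<close>. By \<open>J_\<Psi>\<close> the Jacobians of the two factors multiply to
      the one at u + v.\<close>
    define \<Psi> where "\<Psi> w = (\<phi> (exp (w / 2)) + \<phi> (- exp (w / 2))) * ennreal (exp (w / 2) / 2)" for w :: real
    have [measurable]: "\<Psi> \<in> borel_measurable borel" unfolding \<Psi>_def by measurable
    have J_even: "J (- x) = J x" for x by (simp add: J_def add.commute)
    have J_\<Psi>: "J (exp (u / 2)) * ennreal (exp (u / 2)) = (\<integral>\<^sup>+v. \<Psi> (u + v) * Q v \<partial>lborel)" for u
    proof -
      have "J (exp (u / 2)) * ennreal (exp (u / 2)) = (\<integral>\<^sup>+v. (\<phi> (exp (u / 2) * exp (v / 2)) + \<phi> (- (exp (u / 2) * exp (v / 2))))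
          * ennreal (exp (v / 2) / 2) * Q v * ennreal (exp (u / 2)) \<partial>lborel)"
        unfolding J_def by (rule nn_integral_multc[symmetric]) measurable
      also have "\<dots> = (\<integral>\<^sup>+v. \<Psi> (u + v) * Q v \<partial>lborel)"
      proof (intro nn_integral_cong)
        fix v
        have "ennreal (exp ((u + v) / 2) / 2) = ennreal (exp (v / 2) / 2) * ennreal (exp (u / 2))"
          by (simp add: add_divide_distrib exp_add mult.commute flip: ennreal_mult')
        then show "(\<phi> (exp (u / 2) * exp (v / 2)) + \<phi> (- (exp (u / 2) * exp (v / 2)))) * ennreal (exp (v / 2) / 2) * Q v * ennreal (exp (u / 2))
          = \<Psi> (u + v) * Q v"
          by (simp add: \<Psi>_def add_divide_distrib exp_add mult_ac)
      qed
      finally show ?thesis .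
    qed
    have "emeasure (distr M lborel (\<lambda>\<omega>. X \<omega> * Y \<omega>)) A = (\<integral>\<^sup>+z. \<phi> z \<partial>distr M lborel (\<lambda>\<omega>. X \<omega> * Y \<omega>))"
      by (simp add: \<phi>_def)
    also have "\<dots> = (\<integral>\<^sup>+\<omega>. \<phi> (X \<omega> * Y \<omega>) \<partial>M)" by (subst nn_integral_distr) auto
    also have "\<dots> = (\<integral>\<^sup>+p. \<phi> (fst p * snd p) \<partial>distr M (borel \<Otimes>\<^sub>M borel) (\<lambda>\<omega>. (X \<omega>, Y \<omega>)))"
      by (subst nn_integral_distr) auto
    also have "\<dots> = (\<integral>\<^sup>+p. \<phi> (fst p * snd p) \<partial>(distr M borel X \<Otimes>\<^sub>M distr M borel Y))"
      using ind unfolding indep_var_distribution_eq by simp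
    also have "\<dots> = (\<integral>\<^sup>+x. \<integral>\<^sup>+y. \<phi> (x * y) \<partial>distr M borel Y \<partial>distr M borel X)"
      by (subst dY.nn_integral_fst[symmetric]) (auto simp: measurable_distr_eq1)
    also have "\<dots> = (\<integral>\<^sup>+x. P (ln (x\<^sup>2)) * (\<integral>\<^sup>+y. Q (ln (y\<^sup>2)) * \<phi> (x * y) \<partial>lborel) \<partial>lborel)"
      unfolding dX dY by (simp add: nn_integral_density)
    also have "\<dots> = (\<integral>\<^sup>+x. J x * P (ln (x\<^sup>2)) \<partial>lborel)"
    proof (intro nn_integral_cong)
      fix x :: real
      have "(\<integral>\<^sup>+y. Q (ln (y\<^sup>2)) * \<phi> (x * y) \<partial>lborel) = (\<integral>\<^sup>+y. \<phi> (x * y) * Q (ln (y\<^sup>2)) \<partial>lborel)"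
        by (simp add: mult.commute)
      also have "\<dots> = J x"
        unfolding J_def by (subst nn_integral_ln_square) auto
      finally show "P (ln (x\<^sup>2)) * (\<integral>\<^sup>+y. Q (ln (y\<^sup>2)) * \<phi> (x * y) \<partial>lborel) = J x * P (ln (x\<^sup>2))"
        by (simp add: mult.commute)
    qed
    also have "\<dots> = (\<integral>\<^sup>+u. (J (exp (u / 2)) + J (- exp (u / 2))) * ennreal (exp (u / 2) / 2) * P u \<partial>lborel)"
      by (rule nn_integral_ln_square) measurable
    \<comment> \<open>Since \<open>J\<close> is even, the two signs of x contribute equally and
      cancel the factor 1/2.\<close>
    also have "\<dots> = (\<integral>\<^sup>+u. (J (exp (u / 2)) * ennreal (exp (u / 2))) * P u \<partial>lborel)"
    proof (intro nn_integral_cong)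
      fix u :: real
      have "J (exp (u / 2)) + J (- exp (u / 2)) = J (exp (u / 2)) * 2"
        by (simp add: J_even mult_2_right)
      moreover have "2 * ennreal (exp (u / 2) / 2) = ennreal (exp (u / 2))"
        by (simp flip: ennreal_numeral ennreal_mult')
      ultimately show "(J (exp (u / 2)) + J (- exp (u / 2))) * ennreal (exp (u / 2) / 2) * P u
          = (J (exp (u / 2)) * ennreal (exp (u / 2))) * P u"
        by (simp add: mult.assoc)
    qed
    also have "\<dots> = (\<integral>\<^sup>+u. \<integral>\<^sup>+v. \<Psi> (u + v) * Q v * P u \<partial>lborel \<partial>lborel)"
      unfolding J_\<Psi> by (subst nn_integral_multc) auto
    also have "\<dots> = (\<integral>\<^sup>+u. \<integral>\<^sup>+w. \<Psi> w * Q (w - u) * P u \<partial>lborel \<partial>lborel)"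
    proof (rule nn_integral_cong)
      fix u :: real
      show "(\<integral>\<^sup>+v. \<Psi> (u + v) * Q v * P u \<partial>lborel) = (\<integral>\<^sup>+w. \<Psi> w * Q (w - u) * P u \<partial>lborel)"
        by (subst nn_integral_real_affine[where c = 1 and t = u, of "\<lambda>w. \<Psi> w * Q (w - u) * P u"]) auto
    qed
    also have "\<dots> = (\<integral>\<^sup>+w. \<integral>\<^sup>+u. \<Psi> w * Q (w - u) * P u \<partial>lborel \<partial>lborel)"
      by (rule lborel_pair.Fubini') measurable
    also have "\<dots> = (\<integral>\<^sup>+w. \<Psi> w * (\<integral>\<^sup>+u. P u * Q (w - u) \<partial>lborel) \<partial>lborel)"
      by (subst nn_integral_cmult[symmetric]) (auto simp: mult_ac)
    also have "\<dots> = (\<integral>\<^sup>+x. \<phi> x * (\<integral>\<^sup>+u. P u * Q (ln (x\<^sup>2) - u) \<partial>lborel) \<partial>lborel)"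
      unfolding \<Psi>_def by (rule nn_integral_ln_square[symmetric]) measurable
    also have "\<dots> = emeasure (density lborel (\<lambda>x. \<integral>\<^sup>+u. P u * Q (ln (x\<^sup>2) - u) \<partial>lborel)) A"
      by (subst emeasure_density) (auto simp: \<phi>_def mult.commute)
    finally show "emeasure (distr M lborel (\<lambda>\<omega>. X \<omega> * Y \<omega>)) A
      = emeasure (density lborel (\<lambda>x. \<integral>\<^sup>+u. P u * Q (ln (x\<^sup>2) - u) \<partial>lborel)) A" .
  qed simp
qed

section \<open>The variance-gamma density as a two-parameter G-function\<close>

text \<open>Associativity of convolution: two parameters are absorbed as one block, the block that
  belongs to a single variance-gamma factor.\<close>

lemma meijer_E_Cons_Cons:
  assumes bs: "\<forall>b\<in>set bs. c + b > 0" "bs \<noteq> []" and b: "c + b1 > 0" "c + b2 > 0"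
  shows "meijer_E c (b1 # b2 # bs) y = (\<integral>\<^sup>+v. meijer_E c [b1, b2] v * meijer_E c bs (y - v) \<partial>lborel)"
proof -
  note [measurable] = measurable_meijer_E[OF bs(1)]
  let ?g1 = "\<lambda>v. ennreal (gumbel_kernel b1 v)" and ?g2 = "\<lambda>v. ennreal (gumbel_kernel b2 v)"
  have "meijer_E c (b1 # b2 # bs) y = (\<integral>\<^sup>+u. ?g1 u * (\<integral>\<^sup>+v. ?g2 v * meijer_E c bs (y - u - v) \<partial>lborel) \<partial>lborel)"
    using assms by (simp add: meijer_E_Cons)
  also have "\<dots> = (\<integral>\<^sup>+u. \<integral>\<^sup>+w. ?g1 u * ?g2 (w - u) * meijer_E c bs (y - w) \<partial>lborel \<partial>lborel)"
  proof (intro nn_integral_cong)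
    fix u
    have "(\<integral>\<^sup>+v. ?g2 v * meijer_E c bs (y - u - v) \<partial>lborel) = (\<integral>\<^sup>+w. ?g2 (w - u) * meijer_E c bs (y - w) \<partial>lborel)"
      by (subst nn_integral_real_affine[where c = 1 and t = u, of "\<lambda>w. ?g2 (w - u) * meijer_E c bs (y - w)"])
        (auto simp: diff_diff_eq)
    then show "?g1 u * (\<integral>\<^sup>+v. ?g2 v * meijer_E c bs (y - u - v) \<partial>lborel)
      = (\<integral>\<^sup>+w. ?g1 u * ?g2 (w - u) * meijer_E c bs (y - w) \<partial>lborel)"
      by (simp add: nn_integral_cmult mult.assoc)
  qed
  also have "\<dots> = (\<integral>\<^sup>+w. \<integral>\<^sup>+u. ?g1 u * ?g2 (w - u) * meijer_E c bs (y - w) \<partial>lborel \<partial>lborel)"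
    by (rule lborel_pair.Fubini') measurable
  also have "\<dots> = (\<integral>\<^sup>+w. meijer_E c [b1, b2] w * meijer_E c bs (y - w) \<partial>lborel)"
    using b by (simp add: nn_integral_multc meijer_E_Cons meijer_E_singleton)
  finally show ?thesis .
qed

text \<open>The convolution for \<open>[(r - 1) / 2, 0]\<close> is evaluated at 2 l with l = ln (|x|
  / (2 \<sigma>)). Centring at v = l + t yields exp (l + t) + exp (l - t) = (|x| / \<sigma>) cosh t,
  the exponent in the Bessel integral.\<close>

lemma ennreal_vg_density:
  assumes \<sigma>: "\<sigma> > 0" and r: "r > 0" and c: "c + (r - 1) / 2 > 0" "c > 0" and x: "x \<noteq> 0"
  shows "ennreal (vg_density r \<sigma> x) =
    ennreal (1 / (2 * \<sigma> * sqrt pi * Gamma (r / 2))) * meijer_E c [(r - 1) / 2, 0] (ln (x\<^sup>2) - ln (4 * \<sigma>\<^sup>2))"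
proof -
  define a where "a = (r - 1) / 2"
  define l where "l = ln (\<bar>x\<bar> / (2 * \<sigma>))"
  define m where "m = \<bar>x\<bar> / \<sigma>"
  have el: "exp l = \<bar>x\<bar> / (2 * \<sigma>)" using x \<sigma> by (simp add: l_def)
  have m: "m = 2 * exp l" using \<sigma> by (simp add: el m_def)
  have y: "ln (x\<^sup>2) - ln (4 * \<sigma>\<^sup>2) = 2 * l"
  proof -
    have "2 * l = ln ((\<bar>x\<bar> / (2 * \<sigma>))\<^sup>2)" using x \<sigma> by (simp add: l_def ln_realpow)
    also have "(\<bar>x\<bar> / (2 * \<sigma>))\<^sup>2 = x\<^sup>2 / (4 * \<sigma>\<^sup>2)" by (simp add: power_divide power_mult_distrib)
    finally show ?thesis using x \<sigma> by (simp add: ln_div)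
  qed
  have "meijer_E c [a, 0] (2 * l) = (\<integral>\<^sup>+v. ennreal (gumbel_kernel a v) * ennreal (gumbel_kernel 0 (2 * l - v)) \<partial>lborel)"
    using c by (subst meijer_E_Cons) (auto simp: meijer_E_singleton a_def)
  also have "\<dots> = (\<integral>\<^sup>+t. ennreal (gumbel_kernel a (l + t)) * ennreal (gumbel_kernel 0 (2 * l - (l + t))) \<partial>lborel)"
    by (subst nn_integral_real_affine[where c = 1 and t = l]) auto
  also have "\<dots> = (\<integral>\<^sup>+t. ennreal (exp (a * l)) * ennreal (exp (a * t) * exp (- m * cosh t)) \<partial>lborel)"
  proof (intro nn_integral_cong)
    fix t
    have "gumbel_kernel a (l + t) * gumbel_kernel 0 (2 * l - (l + t)) = exp (a * l) * (exp (a * t) * exp (- m * cosh t))"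
    proof -
      have "m * cosh t = exp (l + t) + exp (l + - t)"
        unfolding exp_add m by (simp add: cosh_def algebra_simps)
      then show ?thesis
        unfolding gumbel_kernel_def exp_add[symmetric] by (simp add: algebra_simps)
    qed
    then show "ennreal (gumbel_kernel a (l + t)) * ennreal (gumbel_kernel 0 (2 * l - (l + t)))
      = ennreal (exp (a * l)) * ennreal (exp (a * t) * exp (- m * cosh t))"
      by (simp flip: ennreal_mult')
  qed
  also have "\<dots> = ennreal (exp (a * l)) * (\<integral>\<^sup>+t. ennreal (exp (a * t) * exp (- m * cosh t)) \<partial>lborel)"
    by (rule nn_integral_cmult) (simp add: cosh_def)
  finally have E: "meijer_E c [a, 0] (2 * l) = ennreal (exp (a * l)) * (\<integral>\<^sup>+t. ennreal (exp (a * t) * exp (- m * cosh t)) \<partial>lborel)" .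
  \<comment> \<open>As cosh is even, folding the line onto the half-line replaces exp (a t) by 2
    cosh (a t).\<close>
  have K: "(\<integral>\<^sup>+t. ennreal (exp (a * t) * exp (- m * cosh t)) \<partial>lborel) = ennreal (2 * bessel_K a m)"
  proof -
    let ?h = "\<lambda>t. indicator {0..} t * (exp (- m * cosh t) * cosh (a * t))"
    have cosh_double_exp: "2 * (cosh (t * a) * u) = exp (t * a) * u + exp (- (t * a)) * u" for t u :: real
      by (simp add: cosh_def algebra_simps)
    have *: "(\<integral>\<^sup>+t. ennreal (exp (a * t) * exp (- m * cosh t)) \<partial>lborel) = (\<integral>\<^sup>+t. ennreal (2 * ?h t) \<partial>lborel)"
    proof (subst nn_integral_split_reflect)
      show "(\<lambda>t. ennreal (exp (a * t) * exp (- m * cosh t))) \<in> borel_measurable borel" by (simp add: cosh_def)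
      show "(\<integral>\<^sup>+t. (ennreal (exp (a * t) * exp (- m * cosh t)) + ennreal (exp (a * - t) * exp (- m * cosh (- t)))) * indicator {0<..} t \<partial>lborel)
        = (\<integral>\<^sup>+t. ennreal (2 * ?h t) \<partial>lborel)"
        by (intro nn_integral_cong_AE eventually_mono[OF AE_lborel_singleton[of 0]])
          (auto simp: cosh_double_exp algebra_simps simp flip: ennreal_plus split: split_indicator)
    qed
    \<comment> \<open>Finiteness rules out the default value 0 of a divergent integral in
      \<open>bessel_K\<close>. It follows from \<open>E\<close>: the left side is
      \<open>ennreal\<close> of a real number and exp (a l) > 0.\<close>
    have "(\<integral>\<^sup>+t. ennreal (2 * ?h t) \<partial>lborel) < \<infinity>"
    proof (rule ccontr)
      assume "\<not> (\<integral>\<^sup>+t. ennreal (2 * ?h t) \<partial>lborel) < \<infinity>"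
      then have "meijer_E c [a, 0] (2 * l) = \<infinity>"
        unfolding E * by (simp add: ennreal_mult_top less_top[symmetric])
      then show False by (simp add: meijer_E_def)
    qed
    then have int: "integrable lborel (\<lambda>t. 2 * ?h t)" by (intro integrableI_nonneg) (simp add: cosh_def, auto)
    have "(\<integral>\<^sup>+t. ennreal (2 * ?h t) \<partial>lborel) = ennreal (\<integral>t. 2 * ?h t \<partial>lborel)"
      using int by (intro nn_integral_eq_integral) auto
    also have "(\<integral>t. 2 * ?h t \<partial>lborel) = 2 * bessel_K a m"
      unfolding bessel_K_def set_lebesgue_integral_def by simp
    finally show ?thesis using * by simp
  qed
  have G: "Gamma (r / 2) > 0" using r by (intro Gamma_real_pos) simp
  have "vg_density r \<sigma> x = 1 / (2 * \<sigma> * sqrt pi * Gamma (r / 2)) * (exp (a * l) * (2 * bessel_K a m))"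
    unfolding vg_density_def a_def[symmetric] m_def[symmetric] el[symmetric]
    by (simp add: powr_def)
  then show ?thesis
    unfolding y a_def[symmetric] E K using \<sigma> G by (simp flip: ennreal_mult')
qed

section \<open>The product density\<close>

theorem mainTheorem3:
  fixes M :: "'a measure" and n :: nat and Z :: "nat \<Rightarrow> 'a \<Rightarrow> real"
    and r \<sigma> :: "nat \<Rightarrow> real" and c :: real
  assumes "prob_space M"
    and "n \<ge> 1"
    and "\<And>i. i \<in> {1..n} \<Longrightarrow> r i > 0"
    and "\<And>i. i \<in> {1..n} \<Longrightarrow> \<sigma> i > 0"
    and "prob_space.indep_vars M (\<lambda>_. borel) Z {1..n}"
    and "\<And>i. i \<in> {1..n} \<Longrightarrow>
           distributed M lborel (Z i) (\<lambda>x. ennreal (vg_density (r i) (\<sigma> i) x))"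
    and "\<And>b. b \<in> set (map (\<lambda>j. (r j - 1) / 2) [1..<n+1] @ replicate n 0) \<Longrightarrow> c > - b"
  shows "\<exists>p :: real \<Rightarrow> real.
      (\<forall>x. p x \<ge> 0) \<and>
      distributed M lborel (\<lambda>\<omega>. \<Prod>i=1..n. Z i \<omega>) (\<lambda>x. ennreal (p x)) \<and>
      (\<forall>x. x \<noteq> 0 \<longrightarrow>
         complex_of_real (p x) =
           complex_of_real (1 / (2 ^ n * pi powr (real n / 2) * (\<Prod>i=1..n. \<sigma> i))
             * (\<Prod>j=1..n. 1 / Gamma (r j / 2)))
           * meijer_G c (map (\<lambda>j. (r j - 1) / 2) [1..<n+1] @ replicate n 0)
               (x\<^sup>2 / (2 ^ (2 * n) * (\<Prod>i=1..n. \<sigma> i)\<^sup>2)))"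
proof -
  interpret prob_space M by fact
  \<comment> \<open>Factor j contributes the parameters \<open>a j\<close> and 0, the constant
    \<open>k j\<close>, and the shift \<open>d j\<close> of ln (x^2) caused by the scale.\<close>
  define a where "a j = (r j - 1) / 2" for j
  define d where "d j = ln (4 * (\<sigma> j)\<^sup>2)" for j
  define k where "k j = 1 / (2 * \<sigma> j * sqrt pi * Gamma (r j / 2))" for j
  define B where "B m = map a [1..<m+1] @ replicate m 0" for m
  have B_n: "map (\<lambda>j. (r j - 1) / 2) [1..<n+1] @ replicate n 0 = B n"
    by (simp add: B_def a_def[abs_def])
  \<comment> \<open>Since n >= 1, the number 0 occurs among the parameters.\<close>
  have c0: "c > 0" using assms(7)[of 0] \<open>n \<ge> 1\<close> by simp
  have ca: "c + a j > 0" if "j \<in> {1..n}" for j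
  proof -
    have "a j \<in> set (B n)" using that by (auto simp: B_def simp del: upt_Suc)
    then show ?thesis using assms(7)[of "a j"] unfolding B_n by simp
  qed
  have cB: "\<forall>b\<in>set (B m). c + b > 0" if "m \<le> n" for m
    using that c0 ca by (auto simp: B_def)
  have k: "k j > 0" if "j \<in> {1..n}" for j
    using assms(3,4)[OF that] by (simp add: k_def Gamma_real_pos)
  have Z: "distributed M lborel (Z j) (\<lambda>x. ennreal (k j) * meijer_E c [a j, 0] (ln (x\<^sup>2) - d j))"
    if j: "j \<in> {1..n}" for j
  proof -
    have [measurable]: "meijer_E c [a j, 0] \<in> borel_measurable borel"
      using c0 ca[OF j] by (intro measurable_meijer_E) auto
    \<comment> \<open>The two densities are compared only off the null point 0, where both may take
      default values.\<close>
    have "AE x in lborel. ennreal (vg_density (r j) (\<sigma> j) x) = ennreal (k j) * meijer_E c [a j, 0] (ln (x\<^sup>2) - d j)"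
      using AE_lborel_singleton[of 0]
      by eventually_elim (use assms(3,4)[OF j] ca[OF j] c0 in \<open>auto simp: ennreal_vg_density a_def d_def k_def\<close>)
    then show ?thesis
      using assms(6)[OF j] distributed_borel_measurable[OF assms(6)[OF j]]
      by (subst (asm) distributed_cong_density) auto
  qed
  \<comment> \<open>Induction over the number of factors: constants multiply, logarithmic shifts
    add, and each step convolves with one more two-parameter block.\<close>
  have key: "distributed M lborel (\<lambda>\<omega>. \<Prod>i=1..m. Z i \<omega>)
      (\<lambda>x. ennreal (\<Prod>i=1..m. k i) * meijer_E c (B m) (ln (x\<^sup>2) - (\<Sum>i=1..m. d i)))"
    if "1 \<le> m" "m \<le> n" for m
    using that
  proof (induction m rule: nat_induct_at_least)
    case base
    then show ?case using Z[of 1] by (simp add: B_def)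
  next
    case (Suc m)
    have j: "Suc m \<in> {1..n}" using Suc by simp
    have m: "m \<le> n" using Suc by simp
    have [measurable]: "meijer_E c [a (Suc m), 0] \<in> borel_measurable borel"
      using c0 ca[OF j] by (intro measurable_meijer_E) auto
    have [measurable]: "meijer_E c (B m) \<in> borel_measurable borel"
      using cB[OF m] by (rule measurable_meijer_E)
    have "indep_vars (\<lambda>_. borel) Z (insert (Suc m) {1..m})"
      using Suc by (intro indep_vars_subset[OF assms(5)]) auto
    then have "indep_var borel (Z (Suc m)) borel (\<lambda>\<omega>. \<Prod>i=1..m. Z i \<omega>)"
      by (intro indep_vars_prod) auto
    from distributed_mult_ln_square[OF this, of
        "\<lambda>y. ennreal (k (Suc m)) * meijer_E c [a (Suc m), 0] (y - d (Suc m))"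
        "\<lambda>y. ennreal (\<Prod>i=1..m. k i) * meijer_E c (B m) (y - (\<Sum>i=1..m. d i))"]
    have "distributed M lborel (\<lambda>\<omega>. Z (Suc m) \<omega> * (\<Prod>i=1..m. Z i \<omega>))
      (\<lambda>x. \<integral>\<^sup>+u. (ennreal (k (Suc m)) * meijer_E c [a (Suc m), 0] (u - d (Suc m))) *
          (ennreal (\<Prod>i=1..m. k i) * meijer_E c (B m) (ln (x\<^sup>2) - u - (\<Sum>i=1..m. d i))) \<partial>lborel)"
      using Z[OF j] Suc by simp
    moreover have "(\<integral>\<^sup>+u. (ennreal (k (Suc m)) * meijer_E c [a (Suc m), 0] (u - d (Suc m))) *
          (ennreal (\<Prod>i=1..m. k i) * meijer_E c (B m) (y - u - (\<Sum>i=1..m. d i))) \<partial>lborel)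
        = ennreal (\<Prod>i=1..Suc m. k i) * meijer_E c (B (Suc m)) (y - (\<Sum>i=1..Suc m. d i))" for y
    proof -
      have kk: "ennreal (\<Prod>i=1..Suc m. k i) = ennreal (k (Suc m)) * ennreal (\<Prod>i=1..m. k i)"
        using k[OF j] by (simp add: ennreal_mult' mult.commute)
      have "B m \<noteq> []" using Suc by (simp add: B_def)
      \<comment> \<open>\<open>B (Suc m)\<close> has its new entries in the middle and at the end,
        so a permutation is needed before \<open>meijer_E_Cons_Cons\<close> applies.\<close>
      moreover have "meijer_E c (B (Suc m)) = meijer_E c (a (Suc m) # 0 # B m)"
        unfolding meijer_E_def[abs_def] by (subst meijer_G_mset_cong[of "B (Suc m)" "a (Suc m) # 0 # B m"]) (auto simp: B_def)
      ultimately have "meijer_E c (B (Suc m)) (y - (\<Sum>i=1..Suc m. d i))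
          = (\<integral>\<^sup>+v. meijer_E c [a (Suc m), 0] v * meijer_E c (B m) (y - (\<Sum>i=1..Suc m. d i) - v) \<partial>lborel)"
        using cB[OF m] ca[OF j] c0 by (simp add: meijer_E_Cons_Cons)
      also have "\<dots> = (\<integral>\<^sup>+u. meijer_E c [a (Suc m), 0] (u - d (Suc m)) * meijer_E c (B m) (y - u - (\<Sum>i=1..m. d i)) \<partial>lborel)"
        by (subst nn_integral_real_affine[where c = 1 and t = "- d (Suc m)"]) (auto simp: algebra_simps)
      finally have E: "meijer_E c (B (Suc m)) (y - (\<Sum>i=1..Suc m. d i))
          = (\<integral>\<^sup>+u. meijer_E c [a (Suc m), 0] (u - d (Suc m)) * meijer_E c (B m) (y - u - (\<Sum>i=1..m. d i)) \<partial>lborel)" .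
      show ?thesis
        unfolding kk E by (subst nn_integral_cmult[symmetric]) (auto simp: mult_ac)
    qed
    ultimately show ?case by (simp add: mult.commute)
  qed
  define K where "K = (\<Prod>i=1..n. k i)"
  define D where "D = (\<Sum>i=1..n. d i)"
  \<comment> \<open>At x = 0 this depends on the convention for \<open>ln 0\<close>; the closed
    formula is therefore derived for nonzero x only.\<close>
  define p where "p x = K * Re (meijer_G c (B n) (exp (ln (x\<^sup>2) - D)))" for x
  have Kpos: "K > 0" unfolding K_def using k by (intro prod_pos) auto
  have Bne: "B n \<noteq> []" using \<open>n \<ge> 1\<close> by (simp add: B_def)
  note G = meijer_G_exp_nonneg_real[OF cB[OF order_refl] Bne]
  have K: "K = 1 / (2 ^ n * pi powr (real n / 2) * (\<Prod>i=1..n. \<sigma> i)) * (\<Prod>j=1..n. 1 / Gamma (r j / 2))"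
  proof -
    have "sqrt pi ^ n = pi powr (real n / 2)"
      by (simp add: powr_half_sqrt[symmetric] powr_powr flip: powr_realpow)
    then show ?thesis
      by (simp add: K_def k_def prod_dividef prod.distrib)
  qed
  \<comment> \<open>The shifts sum to the logarithm of the product of the 4 \<sigma>_i^2, which
    gives the scaling of the argument.\<close>
  have D: "exp (ln (x\<^sup>2) - D) = x\<^sup>2 / (2 ^ (2 * n) * (\<Prod>i=1..n. \<sigma> i)\<^sup>2)" if "x \<noteq> 0" for x
  proof -
    have "exp D = (\<Prod>i=1..n. exp (d i))" unfolding D_def by (simp add: exp_sum)
    also have "\<dots> = (\<Prod>i=1..n. 4 * (\<sigma> i)\<^sup>2)"
      using assms(4) by (intro prod.cong) (force simp: d_def)+
    also have "\<dots> = 2 ^ (2 * n) * (\<Prod>i=1..n. \<sigma> i)\<^sup>2"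
      by (simp add: prod.distrib prod_power_distrib power_mult)
    finally show ?thesis using that by (simp add: exp_diff)
  qed
  show ?thesis
  proof (intro exI[of _ p] conjI allI impI)
    show "p x \<ge> 0" for x using G Kpos by (simp add: p_def)
    show "distributed M lborel (\<lambda>\<omega>. \<Prod>i=1..n. Z i \<omega>) (\<lambda>x. ennreal (p x))"
      using key[OF \<open>n \<ge> 1\<close> order_refl] Kpos by (simp add: p_def meijer_E_def ennreal_mult' K_def D_def)
    fix x :: real assume "x \<noteq> 0"
    have "complex_of_real (p x) = complex_of_real K * meijer_G c (B n) (exp (ln (x\<^sup>2) - D))"
      using G[of "ln (x\<^sup>2) - D"] by (simp add: p_def)
    then show "complex_of_real (p x) =
           complex_of_real (1 / (2 ^ n * pi powr (real n / 2) * (\<Prod>i=1..n. \<sigma> i))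
             * (\<Prod>j=1..n. 1 / Gamma (r j / 2)))
           * meijer_G c (map (\<lambda>j. (r j - 1) / 2) [1..<n+1] @ replicate n 0)
               (x\<^sup>2 / (2 ^ (2 * n) * (\<Prod>i=1..n. \<sigma> i)\<^sup>2))"
      unfolding B_n D[OF \<open>x \<noteq> 0\<close>, symmetric] K[symmetric] .
  qed
qed

end
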